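(* Let $k\in\mathbb{N}$ and let $f_1,\dots,f_k\in\mathbb{C}[x]$ be polynomials with $f_i(0)=0$ and $\deg(f_i)=m_i\ge 1$ for $i=1,\dots,k$. Then for $n\in\mathbb{N}$ $$\sum_{\pi\in\mathcal{P}(n)}\ \prod_{i=1}^k\Big(\sum_{V\in\pi}f_i(|V|)\Big)\,\mu_n(\pi,1_n)=\begin{cases}(n-1)!\,n^{k-1}\prod_{i=1}^k m_i\,\mathrm{lead}(f_i), & n=\sum_{i=1}^k m_i-(k-1),\\[2pt] 0, & n>\sum_{i=1}^k m_i-(k-1).\end{cases}$$
   Context: $\mathcal{P}(n)$ is the set of all set partitions of $[n]=\{1,\dots,n\}$, ordered by $\pi\le\sigma$ iff every block of $\pi$ is contained in a block of $\sigma$; $1_n=\{\{1,\dots,n\}\}$ is its maximum. $\mu_n$ is the Möbius function of the poset $\mathcal{P}(n)$; in particular $\mu_n(\pi,1_n)=(-1)^{|\pi|-1}(|\pi|-1)!$, where $|\pi|$ is the number of blocks of $\pi$. $V\in\pi$ means $V$ is a block of $\pi$ and $|V|$ is its cardinality. $\mathrm{lead}(f)$ is the leading coefficient of $f$. *)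

theory Defs
  imports
    Complex_Main
    "HOL-Library.Disjoint_Sets"
    "HOL-Computational_Algebra.Polynomial"
begin

definition set_partitions :: "nat \<Rightarrow> nat set set set" where
  "set_partitions n = {\<pi>. partition_on {1..n} \<pi>}"

(* The maximum of the partition lattice; meant for n >= 1, as the only partition of the
   empty set is {}, not {{}}. *)
definition top_partition :: "nat \<Rightarrow> nat set set" where
  "top_partition n = {{1..n}}"

(* The Moebius function of the poset of set partitions of {1..n} under refinement,
   by the usual recursion mu(x,x) = 1 and mu(x,y) = - (sum of mu(x,z) over x <= z < y). *)
function partition_mobius :: "nat \<Rightarrow> nat set set \<Rightarrow> nat set set \<Rightarrow> int" where
  "partition_mobius n \<pi> \<sigma> =
     (if \<not> refines {1..n} \<pi> \<sigma> then 0
      else if \<pi> = \<sigma> then 1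
      else - (\<Sum>\<tau> | refines {1..n} \<pi> \<tau> \<and> refines {1..n} \<tau> \<sigma> \<and> \<tau> \<noteq> \<sigma>.
                partition_mobius n \<pi> \<tau>))"
  by pat_completeness auto
termination
proof (relation "measure (\<lambda>(n, \<pi>, \<sigma>). card {\<rho>. refines {1..n} \<rho> \<sigma>})")
  show "wf (measure (\<lambda>(n, \<pi>::nat set set, \<sigma>). card {\<rho>. refines {1..n} \<rho> \<sigma>}))"
    by simp
next
  fix n :: nat and \<pi> \<sigma> \<tau> :: "nat set set"
  assume "\<tau> \<in> {\<tau>. refines {1..n} \<pi> \<tau> \<and> refines {1..n} \<tau> \<sigma> \<and> \<tau> \<noteq> \<sigma>}"
  then have le: "refines {1..n} \<tau> \<sigma>" and ne: "\<tau> \<noteq> \<sigma>" by auto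
  have "finite {\<rho>. refines {1..n} \<rho> \<sigma>}"
    by (rule finite_subset[OF _ finitely_many_partition_on[of "{1..n}"]])
       (auto simp: refines_def)
  moreover have "{\<rho>. refines {1..n} \<rho> \<tau>} \<subseteq> {\<rho>. refines {1..n} \<rho> \<sigma>}"
    using le by (blast intro: refines_trans)
  moreover have "\<sigma> \<in> {\<rho>. refines {1..n} \<rho> \<sigma>}"
    using le refines_refl by (auto simp: refines_def)
  moreover have "\<sigma> \<notin> {\<rho>. refines {1..n} \<rho> \<tau>}"
    using le ne by (auto dest: refines_asym)
  ultimately have "card {\<rho>. refines {1..n} \<rho> \<tau>} < card {\<rho>. refines {1..n} \<rho> \<sigma>}"
    by (metis psubsetI psubset_card_mono)
  then show "((n, \<pi>, \<tau>), (n, \<pi>, \<sigma>)) \<in> measure (\<lambda>(n, \<pi>, \<sigma>). card {\<rho>. refines {1..n} \<rho> \<sigma>})"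
    by simp
qed

declare partition_mobius.simps [simp del]

end

theory Submission
  imports Defs
begin

text \<open>
  Write \<open>\<mu>\<close> for the Moebius function and \<open>1\<close> for the maximum of the partition lattice of an
  \<open>n\<close>-element set \<open>X\<close>. The idea is that, at the critical value of \<open>n\<close>, the sum is a weighted count
  of hypertrees on \<open>X\<close>, while above that value there is no connected hypergraph to be counted.

  A polynomial with \<open>f 0 = 0\<close> is a combination of the binomials \<open>x choose j\<close> with \<open>j \<ge> 1\<close>, its
  coefficient at \<open>j = m = degree f\<close> being \<open>m!\<close> times the leading coefficient. The sum of
  \<open>card V choose j\<close> over the blocks \<open>V\<close> of \<open>\<tau>\<close> counts the \<open>j\<close>-sets \<open>A\<close> that lie inside a block, and
  "\<open>\<tau>\<close> coarsens \<open>\<pi>\<close> and has a block containing \<open>A\<close>" means that \<open>\<tau>\<close> coarsens the partition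
  \<open>merge \<pi> A\<close> obtained from \<open>\<pi>\<close> by uniting all blocks that meet \<open>A\<close>. So each factor
  \<open>\<Sum>V\<in>\<tau>. f(card V)\<close> can be traded for a sum over sets \<open>A\<close>, replacing the lower bound \<open>\<pi>\<close> of
  the summation range by \<open>merge \<pi> A\<close> (lemma \<open>sum_coarsenings_expand\<close>). When all factors are used
  up, what remains is the sum of \<open>\<mu>(\<tau>, 1)\<close> over all \<open>\<tau>\<close> above the last partition, which is \<open>1\<close> if
  that partition is the maximum and \<open>0\<close> otherwise. Only the sequences of sets that connect the
  whole of \<open>X\<close> survive.

  A set of size at most \<open>m\<close> lowers the number of blocks by at most \<open>m - 1\<close>, with equality only if it
  has size \<open>m\<close> and its elements lie in different blocks. This gives the vanishing for
  \<open>n > 1 + \<Sum>(m\<^sub>i - 1)\<close>, and at equality only the leading coefficients contribute, through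
  hypertrees. These are counted from an arbitrary starting partition with \<open>r\<close> blocks: with
  weight \<open>w(\<pi>) = \<Prod>V\<in>\<pi>. card V\<close>, the sum of \<open>w(merge \<pi> A)\<close> over all \<open>m\<close>-sets \<open>A\<close> meeting \<open>m\<close> blocks is
  \<open>w(\<pi>) n (r-1 choose m-1)\<close> (lemma \<open>sum_weight_merge\<close>). Hence every set contributes a factor \<open>n\<close>
  and the binomials telescope to \<open>(r-1)!\<close> over the product of the \<open>(m\<^sub>i - 1)!\<close>. As the maximum has
  weight \<open>n\<close>, it is \<open>n\<close> times the number of hypertrees that this computes, which explains the
  exponent \<open>k - 1\<close>. The factors \<open>m\<^sub>i!\<close> from the binomial expansion leave \<open>m\<^sub>i\<close>. This is the
  induction in \<open>sum_block_polynomials_top_mobius\<close>. The theorem is the case where the starting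
  partition consists of singletons.
\<close>

section \<open>The Moebius function below the maximum\<close>

lemma finite_coarsenings: "finite X \<Longrightarrow> finite {\<tau>. refines X \<pi> \<tau>}"
  by (rule finite_subset[OF _ finitely_many_partition_on[of X]]) (auto simp: refines_def)

lemma partition_on_eqI:
  assumes "partition_on X \<pi>" "V \<in> \<pi>" "W \<in> \<pi>" "x \<in> V" "x \<in> W"
  shows "V = W"
  using assms by (metis IntI disjointD empty_iff partition_onD2)

lemma coarsening_block:
  assumes "partition_on X \<pi>" "P \<in> \<pi>" "refines X \<pi> \<tau>"
  obtains V where "V \<in> \<tau>" "P \<subseteq> V"
  using assms by (auto simp: refines_def)

text \<open>
  Deleting the points of one block \<open>P\<close> from a coarsening of \<open>\<pi>\<close> leaves a coarsening \<open>\<sigma>\<close> of the other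
  blocks. Conversely, \<open>P\<close> can be put back either by joining it to a block \<open>W\<close> of \<open>\<sigma>\<close> or as a block of
  its own. Admitting \<open>W = {}\<close> treats the second option uniformly with the first, as \<open>{}\<close> is
  never a block.
\<close>
lemma bij_betw_coarsenings:
  assumes \<pi>: "partition_on X \<pi>" and P: "P \<in> \<pi>"
  shows "bij_betw (\<lambda>(\<sigma>, W). insert (W \<union> P) (\<sigma> - {W}))
           (SIGMA \<sigma>:{\<sigma>. refines (X - P) (\<pi> - {P}) \<sigma>}. insert {} \<sigma>) {\<tau>. refines X \<pi> \<tau>}"
proof -
  let ?F = "\<lambda>(\<sigma>, W). insert (W \<union> P) (\<sigma> - {W})"
  let ?D = "SIGMA \<sigma>:{\<sigma>. refines (X - P) (\<pi> - {P}) \<sigma>}. insert {} \<sigma>"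
  have Pne: "P \<noteq> {}" and PX: "P \<subseteq> X"
    using \<pi> P by (auto simp: partition_on_def)
  obtain p where p: "p \<in> P" using Pne by auto
  have rest: "partition_on (X - P) (\<pi> - {P})"
  proof -
    have "disjnt P (\<Union>(\<pi> - {P}))"
      using \<pi> P by (auto simp: partition_on_def disjoint_def disjnt_def)
    then show ?thesis
      using partition_on_insert[of P "\<pi> - {P}" X] \<pi> P by (simp add: insert_absorb)
  qed
  have away: "P \<inter> V = {}" if "partition_on (X - P) \<sigma>" "V \<in> \<sigma>" for \<sigma> V
    using that by (auto simp: partition_on_def)
  have inj: "inj_on ?F ?D"
  proof (rule inj_onI, clarify)
    fix \<sigma> W \<sigma>' W'
    assume r: "refines (X - P) (\<pi> - {P}) \<sigma>" "refines (X - P) (\<pi> - {P}) \<sigma>'"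
      and W: "W \<in> insert {} \<sigma>" and W': "W' \<in> insert {} \<sigma>'"
      and eq: "insert (W \<union> P) (\<sigma> - {W}) = insert (W' \<union> P) (\<sigma>' - {W'})"
    have s: "partition_on (X - P) \<sigma>" and s': "partition_on (X - P) \<sigma>'"
      using r by (auto simp: refines_def)
    have n: "V \<union> P \<notin> \<sigma>" "V \<union> P \<notin> \<sigma>'" for V
      using away[OF s, of "V \<union> P"] away[OF s', of "V \<union> P"] Pne by auto
    have d: "P \<inter> W = {}" "P \<inter> W' = {}"
      using W W' away[OF s] away[OF s'] by auto
    have "W \<union> P \<in> insert (W' \<union> P) (\<sigma>' - {W'})"
      using eq by (metis insertI1)
    then have "W \<union> P = W' \<union> P"
      using n by simp
    then have ww: "W = W'" using d by blast
    have "\<sigma> - {W} = \<sigma>' - {W'}"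
      using eq n unfolding ww by (subst (asm) insert_ident) simp_all
    moreover have "{} \<notin> \<sigma>" "{} \<notin> \<sigma>'"
      using s s' by (auto simp: partition_on_def)
    ultimately have "\<sigma> = \<sigma>'" using ww W W' by (cases "W = {}") auto
    then show "\<sigma> = \<sigma>' \<and> W = W'" using ww by simp
  qed
  have into: "refines X \<pi> (insert (W \<union> P) (\<sigma> - {W}))"
    if r: "refines (X - P) (\<pi> - {P}) \<sigma>" and W: "W \<in> insert {} \<sigma>" for \<sigma> W
  proof -
    have s: "partition_on (X - P) \<sigma>" using r by (auto simp: refines_def)
    have e: "{} \<notin> \<sigma>" using s by (auto simp: partition_on_def)
    have dW: "disjnt W (\<Union>(\<sigma> - {W}))"
      using W s by (auto simp: partition_on_def disjoint_def disjnt_def)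
    have "partition_on (X - P - W) (\<sigma> - {W})"
    proof (cases "W = {}")
      case True then show ?thesis using s e by simp
    next
      case False
      then show ?thesis
        using partition_on_insert[OF dW, of "X - P"] s W by (simp add: insert_absorb)
    qed
    moreover have "X - P - W = X - (W \<union> P)" by auto
    moreover have "disjnt (W \<union> P) (\<Union>(\<sigma> - {W}))"
      using dW away[OF s] by (auto simp: disjnt_def)
    moreover have "W \<union> P \<subseteq> X" using W s PX by (auto simp: partition_on_def)
    ultimately have "partition_on X (insert (W \<union> P) (\<sigma> - {W}))"
      using partition_on_insert[of "W \<union> P" "\<sigma> - {W}" X] Pne by auto
    moreover have "\<exists>Y\<in>insert (W \<union> P) (\<sigma> - {W}). V \<subseteq> Y" if V: "V \<in> \<pi>" for V
    proof (cases "V = P")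
      case False
      then obtain Y where "Y \<in> \<sigma>" "V \<subseteq> Y" using r V by (auto simp: refines_def)
      then show ?thesis by (cases "Y = W") auto
    qed auto
    ultimately show ?thesis using \<pi> by (auto simp: refines_def)
  qed
  have onto: "\<exists>x\<in>?D. \<tau> = ?F x" if r: "refines X \<pi> \<tau>" for \<tau>
  proof -
    obtain V where V: "V \<in> \<tau>" "P \<subseteq> V" using coarsening_block[OF \<pi> P r] .
    have t: "partition_on X \<tau>" using r by (auto simp: refines_def)
    define W where "W = V - P"
    define \<sigma> where "\<sigma> = (\<tau> - {V}) \<union> ({W} - {{}})"
    have dV: "disjnt V (\<Union>(\<tau> - {V}))"
      using V t by (auto simp: partition_on_def disjoint_def disjnt_def)
    have pV: "partition_on (X - V) (\<tau> - {V})" and VX: "V \<subseteq> X"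
      using partition_on_insert[OF dV, of X] t V by (simp_all add: insert_absorb)
    have WU: "W \<union> P = V" using V W_def by auto
    have s: "partition_on (X - P) \<sigma>"
    proof (cases "W = {}")
      case True
      then have "V = P" using WU by simp
      then show ?thesis using pV True by (simp add: \<sigma>_def)
    next
      case False
      have "X - P - W = X - V" using WU by auto
      moreover have "disjnt W (\<Union>(\<tau> - {V}))" using dV by (auto simp: W_def disjnt_def)
      ultimately show ?thesis
        using partition_on_insert[of W "\<tau> - {V}" "X - P"] pV False VX
        by (auto simp: \<sigma>_def W_def)
    qed
    have "\<exists>Y\<in>\<sigma>. U \<subseteq> Y" if U: "U \<in> \<pi> - {P}" for U
    proof -
      obtain Y where Y: "Y \<in> \<tau>" "U \<subseteq> Y" using r U by (auto simp: refines_def)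
      have UP: "U \<inter> P = {}" "U \<noteq> {}"
        using \<pi> P U by (auto simp: partition_on_def disjoint_def)
      show ?thesis
      proof (cases "Y = V")
        case True
        then have "U \<subseteq> W" using Y UP by (auto simp: W_def)
        then show ?thesis using UP by (auto simp: \<sigma>_def)
      qed (use Y in \<open>auto simp: \<sigma>_def\<close>)
    qed
    then have "refines (X - P) (\<pi> - {P}) \<sigma>" using s rest by (auto simp: refines_def)
    moreover have "W \<in> insert {} \<sigma>" by (auto simp: \<sigma>_def)
    moreover have "\<tau> = insert (W \<union> P) (\<sigma> - {W})"
    proof -
      have "{} \<notin> \<tau>" using t by (auto simp: partition_on_def)
      moreover have "W \<notin> \<tau> - {V}"
      proof
        assume "W \<in> \<tau> - {V}"
        then have "W = {}" using dV unfolding W_def disjnt_def by blast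
        then show False using \<open>{} \<notin> \<tau>\<close> \<open>W \<in> \<tau> - {V}\<close> by simp
      qed
      ultimately have "\<sigma> - {W} = \<tau> - {V}" by (auto simp: \<sigma>_def)
      then show ?thesis using V WU by auto
    qed
    ultimately show ?thesis by (intro bexI[of _ "(\<sigma>, W)"]) auto
  qed
  show ?thesis
    unfolding bij_betw_def
  proof (intro conjI inj equalityI subsetI)
    fix \<tau> assume "\<tau> \<in> ?F ` ?D"
    then obtain \<sigma> W where "refines (X - P) (\<pi> - {P}) \<sigma>" "W \<in> insert {} \<sigma>"
      and "\<tau> = insert (W \<union> P) (\<sigma> - {W})" by auto
    then show "\<tau> \<in> {\<tau>. refines X \<pi> \<tau>}" using into by simp
  next
    fix \<tau> assume "\<tau> \<in> {\<tau>. refines X \<pi> \<tau>}"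
    then show "\<tau> \<in> ?F ` ?D" using onto unfolding image_iff by blast
  qed
qed

definition top_mobius :: "nat \<Rightarrow> int" where
  "top_mobius r = (-1) ^ (r - 1) * fact (r - 1)"

text \<open>
  If \<open>\<pi>\<close> has a second block besides \<open>P\<close>, the sum already vanishes over each set of coarsenings that
  agree away from \<open>P\<close>: if \<open>\<sigma>\<close> is what they share and has \<open>q\<close> blocks, then \<open>q\<close> of them have \<open>q\<close> blocks and
  one has \<open>q + 1\<close> blocks, and \<open>q (-1)^(q-1) (q-1)! + (-1)^q q! = 0\<close>.
\<close>
lemma sum_top_mobius_coarsenings:
  assumes fin: "finite X" and \<pi>: "partition_on X \<pi>" and "X \<noteq> {}"
  shows "(\<Sum>\<tau> | refines X \<pi> \<tau>. top_mobius (card \<tau>)) = (if card \<pi> = 1 then 1 else 0)"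
proof (cases "card \<pi> = 1")
  case True
  then obtain P where "\<pi> = {P}" by (auto simp: card_1_singleton_iff)
  then have p: "\<pi> = {X}" using \<pi> by (auto simp: partition_on_def)
  have "\<tau> = {X}" if "refines X \<pi> \<tau>" for \<tau>
  proof -
    have t: "partition_on X \<tau>" using that by (auto simp: refines_def)
    then have "refines X \<tau> \<pi>" using \<pi> p by (auto simp: refines_def partition_on_def)
    then show ?thesis using that p by (metis refines_asym)
  qed
  then have "{\<tau>. refines X \<pi> \<tau>} = {{X}}"
    using p refines_refl[OF \<pi>] by auto
  then show ?thesis using True by (simp add: top_mobius_def)
next
  case False
  have "\<pi> \<noteq> {}" using \<pi> \<open>X \<noteq> {}\<close> by (auto simp: partition_on_def)
  then obtain P where P: "P \<in> \<pi>" by auto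
  have "\<pi> \<noteq> {P}" using False by auto
  then obtain Q where Q: "Q \<in> \<pi>" "Q \<noteq> P" using P by auto
  have XP: "X - P \<noteq> {}"
  proof -
    have "Q \<noteq> {}" "Q \<subseteq> X" "Q \<inter> P = {}"
      using \<pi> P Q by (auto simp: partition_on_def disjoint_def)
    then show ?thesis by blast
  qed
  have fX: "finite (X - P)" using fin by simp
  have zero: "(\<Sum>W\<in>insert {} \<sigma>. top_mobius (card (insert (W \<union> P) (\<sigma> - {W})))) = 0"
    if r: "refines (X - P) (\<pi> - {P}) \<sigma>" for \<sigma>
  proof -
    have s: "partition_on (X - P) \<sigma>" using r by (auto simp: refines_def)
    have fs: "finite \<sigma>" using finite_elements[OF fX s] .
    have e: "{} \<notin> \<sigma>" using s by (auto simp: partition_on_def)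
    have n: "V \<union> P \<notin> \<sigma>" for V
    proof
      assume "V \<union> P \<in> \<sigma>"
      then have "P \<subseteq> X - P" using s by (auto simp: partition_on_def)
      then have "P = {}" by auto
      then show False using \<pi> P by (auto simp: partition_on_def)
    qed
    have "\<sigma> \<noteq> {}" using s XP by (auto simp: partition_on_def)
    then obtain q where q: "card \<sigma> = Suc q" using fs by (metis card_0_eq not0_implies_Suc)
    have "(\<Sum>W\<in>insert {} \<sigma>. top_mobius (card (insert (W \<union> P) (\<sigma> - {W}))))
        = top_mobius (Suc (card \<sigma>)) + (\<Sum>W\<in>\<sigma>. top_mobius (card \<sigma>))"
    proof -
      have "card (insert (W \<union> P) (\<sigma> - {W})) = card \<sigma>" if "W \<in> \<sigma>" for W
        using that fs n[of W] q by (simp add: card_insert_disjoint card_Diff_singleton)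
      moreover have "card (insert ({} \<union> P) (\<sigma> - {{}})) = Suc (card \<sigma>)"
        using fs n[of "{}"] e by simp
      ultimately show ?thesis using fs e by simp
    qed
    also have "\<dots> = 0" by (simp add: q top_mobius_def)
    finally show ?thesis .
  qed
  have "(\<Sum>\<tau> | refines X \<pi> \<tau>. top_mobius (card \<tau>)) =
     (\<Sum>(\<sigma>, W)\<in>(SIGMA \<sigma>:{\<sigma>. refines (X - P) (\<pi> - {P}) \<sigma>}. insert {} \<sigma>).
        top_mobius (card (insert (W \<union> P) (\<sigma> - {W}))))"
    using sum.reindex_bij_betw[OF bij_betw_coarsenings[OF \<pi> P], of "\<lambda>\<tau>. top_mobius (card \<tau>)"]
    by (simp add: case_prod_unfold)
  also have "\<dots> = (\<Sum>\<sigma> | refines (X - P) (\<pi> - {P}) \<sigma>.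
      \<Sum>W\<in>insert {} \<sigma>. top_mobius (card (insert (W \<union> P) (\<sigma> - {W}))))"
    by (rule sum.Sigma[symmetric])
       (use finite_coarsenings[OF fX] finite_elements[OF fX] in \<open>auto simp: refines_def\<close>)
  also have "\<dots> = 0" using zero by simp
  finally show ?thesis using False by simp
qed

lemma sum_partition_mobius_interval:
  assumes "refines {1..n} \<pi> \<sigma>"
  shows "(\<Sum>\<tau> | refines {1..n} \<pi> \<tau> \<and> refines {1..n} \<tau> \<sigma>. partition_mobius n \<pi> \<tau>)
       = (if \<pi> = \<sigma> then 1 else 0)"
proof -
  let ?I = "{\<tau>. refines {1..n} \<pi> \<tau> \<and> refines {1..n} \<tau> \<sigma>}"
  have s: "partition_on {1..n} \<sigma>" using assms by (auto simp: refines_def)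
  have fin: "finite ?I"
    by (rule finite_subset[OF _ finite_coarsenings[of "{1..n}" \<pi>]]) auto
  show ?thesis
  proof (cases "\<pi> = \<sigma>")
    case True
    then have "?I = {\<sigma>}" using refines_asym refines_refl[OF s] by auto
    then show ?thesis using True refines_refl[OF s] by (simp add: partition_mobius.simps)
  next
    case False
    have "?I - {\<sigma>} = {\<tau>. refines {1..n} \<pi> \<tau> \<and> refines {1..n} \<tau> \<sigma> \<and> \<tau> \<noteq> \<sigma>}" by auto
    moreover have "\<sigma> \<in> ?I" using assms refines_refl[OF s] by simp
    ultimately have "(\<Sum>\<tau>\<in>?I. partition_mobius n \<pi> \<tau>) = partition_mobius n \<pi> \<sigma> +
       (\<Sum>\<tau> | refines {1..n} \<pi> \<tau> \<and> refines {1..n} \<tau> \<sigma> \<and> \<tau> \<noteq> \<sigma>. partition_mobius n \<pi> \<tau>)"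
      using sum.remove[OF fin, of \<sigma>] by simp
    also have "\<dots> = 0" using assms False by (simp add: partition_mobius.simps[of n \<pi> \<sigma>])
    finally show ?thesis using False by simp
  qed
qed

text \<open>
  The recursion defining \<open>\<mu>\<close> says that \<open>\<mu>\<close> is inverse to the zeta function on one side, while
  \<open>sum_top_mobius_coarsenings\<close> says that zeta carries \<open>top_mobius \<circ> card\<close> to the indicator of the
  maximum. Evaluating \<open>\<mu> * zeta * top_mobius\<close> in both ways identifies the two.
\<close>
lemma partition_mobius_top:
  assumes n: "n \<ge> 1" and \<pi>: "partition_on {1..n} \<pi>"
  shows "partition_mobius n \<pi> (top_partition n) = top_mobius (card \<pi>)"
proof -
  let ?X = "{1..n}" and ?C = "{\<tau>. refines {1..n} \<pi> \<tau>}"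
  have fin: "finite ?C" by (rule finite_coarsenings) simp
  have single: "card \<tau> = 1 \<longleftrightarrow> \<tau> = {?X}" if "\<tau> \<in> ?C" for \<tau>
    using that by (auto simp: card_1_singleton_iff refines_def partition_on_def)
  have top: "{?X} \<in> ?C"
    using \<pi> n by (auto simp: refines_def partition_on_def)
  have upper: "{\<rho> \<in> ?C. refines ?X \<tau> \<rho>} = {\<rho>. refines ?X \<tau> \<rho>}" if "\<tau> \<in> ?C" for \<tau>
    using that refines_trans by blast
  have "partition_mobius n \<pi> {?X} = (\<Sum>\<tau>\<in>?C. partition_mobius n \<pi> \<tau> * (if \<tau> = {?X} then 1 else 0))"
    using fin top by (simp add: if_distrib[of "\<lambda>x. a * x" for a] cong: if_cong)
  also have "\<dots> = (\<Sum>\<tau>\<in>?C. partition_mobius n \<pi> \<tau> * (\<Sum>\<rho> | \<rho> \<in> ?C \<and> refines ?X \<tau> \<rho>. top_mobius (card \<rho>)))"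
  proof (rule sum.cong[OF refl])
    fix \<tau> assume t: "\<tau> \<in> ?C"
    then have "partition_on ?X \<tau>" by (auto simp: refines_def)
    then show "partition_mobius n \<pi> \<tau> * (if \<tau> = {?X} then 1 else 0)
       = partition_mobius n \<pi> \<tau> * (\<Sum>\<rho> | \<rho> \<in> ?C \<and> refines ?X \<tau> \<rho>. top_mobius (card \<rho>))"
      using upper[OF t] single[OF t] sum_top_mobius_coarsenings[of ?X \<tau>] n by auto
  qed
  also have "\<dots> = (\<Sum>\<tau>\<in>?C. \<Sum>\<rho> | \<rho> \<in> ?C \<and> refines ?X \<tau> \<rho>. partition_mobius n \<pi> \<tau> * top_mobius (card \<rho>))"
    by (simp add: sum_distrib_left)
  also have "\<dots> = (\<Sum>\<rho>\<in>?C. \<Sum>\<tau> | \<tau> \<in> ?C \<and> refines ?X \<tau> \<rho>. partition_mobius n \<pi> \<tau> * top_mobius (card \<rho>))"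
    by (rule sum.swap_restrict[OF fin fin])
  also have "\<dots> = (\<Sum>\<rho>\<in>?C. (if \<rho> = \<pi> then 1 else 0) * top_mobius (card \<rho>))"
  proof (rule sum.cong[OF refl])
    fix \<rho> assume "\<rho> \<in> ?C"
    then show "(\<Sum>\<tau> | \<tau> \<in> ?C \<and> refines ?X \<tau> \<rho>. partition_mobius n \<pi> \<tau> * top_mobius (card \<rho>))
       = (if \<rho> = \<pi> then 1 else 0) * top_mobius (card \<rho>)"
      using sum_partition_mobius_interval[of n \<pi> \<rho>] by (auto simp flip: sum_distrib_right)
  qed
  also have "\<dots> = (\<Sum>\<rho>\<in>?C. if \<pi> = \<rho> then top_mobius (card \<rho>) else 0)"
    by (rule sum.cong) auto
  also have "\<dots> = top_mobius (card \<pi>)"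
    using fin refines_refl[OF \<pi>] by (subst sum.delta') auto
  finally show ?thesis by (simp add: top_partition_def)
qed

section \<open>Merging the blocks that meet a set\<close>

definition touched :: "'a set set \<Rightarrow> 'a set \<Rightarrow> 'a set set" where
  "touched \<pi> A = {V \<in> \<pi>. V \<inter> A \<noteq> {}}"

definition merge :: "'a set set \<Rightarrow> 'a set \<Rightarrow> 'a set set" where
  "merge \<pi> A = insert (\<Union>(touched \<pi> A)) (\<pi> - touched \<pi> A)"

lemma touched_subset: "touched \<pi> A \<subseteq> \<pi>"
  by (auto simp: touched_def)

lemma subset_Union_touched:
  assumes "partition_on X \<pi>" "A \<subseteq> X"
  shows "A \<subseteq> \<Union>(touched \<pi> A)"
  using assms by (fastforce simp: touched_def partition_on_def)

lemma partition_on_merge: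
  assumes \<pi>: "partition_on X \<pi>" and A: "A \<subseteq> X" "A \<noteq> {}"
  shows "partition_on X (merge \<pi> A)"
proof (rule partition_onI)
  have u: "\<Union>(touched \<pi> A) \<noteq> {}" using subset_Union_touched[OF \<pi> A(1)] A(2) by auto
  show "\<Union>(merge \<pi> A) = X"
    using \<pi> by (auto simp: merge_def touched_def partition_on_def)
  show "{} \<notin> merge \<pi> A"
    using \<pi> u by (auto simp: merge_def partition_on_def)
  fix p q assume pq: "p \<in> merge \<pi> A" "q \<in> merge \<pi> A" "p \<noteq> q"
  have "disjnt V (\<Union>(touched \<pi> A))" "disjnt (\<Union>(touched \<pi> A)) V" if "V \<in> \<pi> - touched \<pi> A" for V
    using that partition_on_eqI[OF \<pi>] touched_subset[of \<pi> A] unfolding disjnt_def by blast+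
  moreover have "disjnt p q" if "p \<in> \<pi>" "q \<in> \<pi>"
    using that pq(3) \<pi> by (auto simp: partition_on_def pairwise_def)
  ultimately show "disjnt p q" using pq by (auto simp: merge_def)
qed

text \<open>
  \<open>merge \<pi> A\<close> is the join of \<open>\<pi>\<close> with the partition whose only block with more than one element
  is \<open>A\<close> (or that has none, if \<open>A\<close> is a singleton), so it has the universal property of a join.
\<close>
lemma refines_merge_iff:
  assumes \<pi>: "partition_on X \<pi>" and A: "A \<subseteq> X" "A \<noteq> {}"
  shows "refines X (merge \<pi> A) \<tau> \<longleftrightarrow> refines X \<pi> \<tau> \<and> (\<exists>V\<in>\<tau>. A \<subseteq> V)"
proof
  assume r: "refines X (merge \<pi> A) \<tau>"
  have "\<exists>Y\<in>merge \<pi> A. V \<subseteq> Y" if "V \<in> \<pi>" for V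
    using that by (cases "V \<in> touched \<pi> A") (auto simp: merge_def)
  then have "refines X \<pi> (merge \<pi> A)"
    using \<pi> partition_on_merge[OF assms] by (auto simp: refines_def)
  then have "refines X \<pi> \<tau>" using r by (rule refines_trans)
  moreover have "\<exists>V\<in>\<tau>. \<Union>(touched \<pi> A) \<subseteq> V"
    using r by (auto simp: refines_def merge_def)
  ultimately show "refines X \<pi> \<tau> \<and> (\<exists>V\<in>\<tau>. A \<subseteq> V)"
    using subset_Union_touched[OF \<pi> A(1)] by blast
next
  assume "refines X \<pi> \<tau> \<and> (\<exists>V\<in>\<tau>. A \<subseteq> V)"
  then obtain V where r: "refines X \<pi> \<tau>" and V: "V \<in> \<tau>" "A \<subseteq> V" by auto
  have t: "partition_on X \<tau>" using r by (auto simp: refines_def)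
  have "W \<subseteq> V" if W: "W \<in> touched \<pi> A" for W
  proof -
    obtain x where x: "x \<in> W" "x \<in> A" using W unfolding touched_def by blast
    obtain Y where Y: "Y \<in> \<tau>" "W \<subseteq> Y" using W r by (auto simp: touched_def refines_def)
    have "Y = V" using partition_on_eqI[OF t Y(1) V(1)] x Y V by auto
    then show ?thesis using Y by simp
  qed
  then have "\<exists>Y\<in>\<tau>. \<Union>(touched \<pi> A) \<subseteq> Y" using V by blast
  then show "refines X (merge \<pi> A) \<tau>"
    using r partition_on_merge[OF assms] t by (auto simp: refines_def merge_def)
qed

lemma Union_touched_notin:
  assumes \<pi>: "partition_on X \<pi>" and A: "A \<subseteq> X" "A \<noteq> {}"
  shows "\<Union>(touched \<pi> A) \<notin> \<pi> - touched \<pi> A"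
proof
  assume u: "\<Union>(touched \<pi> A) \<in> \<pi> - touched \<pi> A"
  then have "\<Union>(touched \<pi> A) \<inter> A = {}" by (auto simp: touched_def)
  then show False using subset_Union_touched[OF \<pi> A(1)] A(2) by blast
qed

lemma card_merge:
  assumes fin: "finite X" and \<pi>: "partition_on X \<pi>" and A: "A \<subseteq> X" "A \<noteq> {}"
  shows "card (merge \<pi> A) + card (touched \<pi> A) = card \<pi> + 1"
proof -
  have fp: "finite \<pi>" using finite_elements[OF fin \<pi>] .
  have "card (touched \<pi> A) \<le> card \<pi>" using fp by (simp add: card_mono touched_subset)
  then show ?thesis
    using Union_touched_notin[OF \<pi> A] fp finite_subset[OF touched_subset fp]
    by (simp add: merge_def card_Diff_subset touched_subset)
qed

lemma card_touched_le:
  assumes \<pi>: "partition_on X \<pi>" and "finite A"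
  shows "card (touched \<pi> A) \<le> card A"
proof -
  define f where "f V = (SOME x. x \<in> V \<inter> A)" for V
  have f: "f V \<in> V \<inter> A" if "V \<in> touched \<pi> A" for V
    unfolding f_def using that by (intro some_in_eq[THEN iffD2]) (auto simp: touched_def)
  have "inj_on f (touched \<pi> A)"
  proof (rule inj_onI)
    fix V W assume "V \<in> touched \<pi> A" "W \<in> touched \<pi> A" "f V = f W"
    then show "V = W"
      using f[of V] f[of W] partition_on_eqI[OF \<pi>, of V W "f V"] touched_subset by auto
  qed
  then show ?thesis
    using card_inj_on_le[of f "touched \<pi> A" A] f \<open>finite A\<close> by auto
qed

text \<open>
  A set that has as many elements as \<open>B\<close> has blocks and meets every block is the image of a unique
  choice function.
\<close>
lemma card_transversals:
  assumes fin: "finite B" and fV: "\<And>V. V \<in> B \<Longrightarrow> finite V" and dis: "disjoint B"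
  shows "card {A. A \<subseteq> \<Union>B \<and> card A = card B \<and> (\<forall>V\<in>B. V \<inter> A \<noteq> {})} = (\<Prod>V\<in>B. card V)"
proof -
  let ?T = "{A. A \<subseteq> \<Union>B \<and> card A = card B \<and> (\<forall>V\<in>B. V \<inter> A \<noteq> {})}"
  have eq: "V = W" if "V \<in> B" "W \<in> B" "x \<in> V" "x \<in> W" for V W x
    using that dis by (metis IntI disjointD empty_iff)
  have injf: "inj_on f B" if "\<And>V. V \<in> B \<Longrightarrow> f V \<in> V" for f
    using that eq by (intro inj_onI) metis
  have "bij_betw (\<lambda>f. f ` B) (\<Pi>\<^sub>E V\<in>B. V) ?T"
  proof (rule bij_betwI')
    fix f g assume f: "f \<in> (\<Pi>\<^sub>E V\<in>B. V)" and g: "g \<in> (\<Pi>\<^sub>E V\<in>B. V)"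
    show "f ` B = g ` B \<longleftrightarrow> f = g"
    proof
      assume e: "f ` B = g ` B"
      show "f = g"
      proof (rule PiE_ext[OF f g])
        fix V assume V: "V \<in> B"
        then obtain W where W: "W \<in> B" "f V = g W" using e by (metis imageE imageI)
        then have "V = W" using eq[OF V W(1), of "f V"] PiE_mem[OF f V] PiE_mem[OF g W(1)] by simp
        then show "f V = g V" using W by simp
      qed
    qed simp
  next
    fix f assume f: "f \<in> (\<Pi>\<^sub>E V\<in>B. V)"
    then have fm: "f V \<in> V" if "V \<in> B" for V using that by auto
    then show "f ` B \<in> ?T"
      using card_image[OF injf[OF fm]] by auto
  next
    fix A assume A: "A \<in> ?T"
    define f where "f = (\<lambda>V\<in>B. SOME x. x \<in> V \<inter> A)"
    have f: "f V \<in> V \<inter> A" if "V \<in> B" for V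
      using that A by (simp add: f_def del: Int_iff) (metis some_in_eq)
    have "finite A" using A fin fV by (auto intro: finite_subset)
    moreover have "f ` B \<subseteq> A" using f by auto
    moreover have "card (f ` B) = card A" using card_image[OF injf, of f] f A by auto
    ultimately have "A = f ` B" by (metis card_subset_eq)
    moreover have "f \<in> (\<Pi>\<^sub>E V\<in>B. V)" using f by (auto simp: f_def)
    ultimately show "\<exists>f\<in>\<Pi>\<^sub>E V\<in>B. V. A = f ` B" by blast
  qed
  then have "card ?T = card (\<Pi>\<^sub>E V\<in>B. V)" by (simp add: bij_betw_same_card)
  then show ?thesis using fin by (simp add: card_PiE)
qed

lemma card_subsets_containing:
  assumes fin: "finite S" and x: "x \<in> S"
  shows "card {B. B \<subseteq> S \<and> card B = Suc j \<and> x \<in> B} = (card S - 1) choose j"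
proof -
  have "bij_betw (insert x) {B. B \<subseteq> S - {x} \<and> card B = j} {B. B \<subseteq> S \<and> card B = Suc j \<and> x \<in> B}"
  proof (rule bij_betw_byWitness[where f' = "\<lambda>B. B - {x}"])
    show "insert x ` {B. B \<subseteq> S - {x} \<and> card B = j} \<subseteq> {B. B \<subseteq> S \<and> card B = Suc j \<and> x \<in> B}"
      using x fin finite_subset[of _ "S - {x}"] by (auto simp: card_insert_if)
  qed (use x in \<open>auto simp: insert_absorb\<close>)
  then show ?thesis
    using n_subsets[of "S - {x}" j] fin x by (simp add: bij_betw_same_card[symmetric])
qed

text \<open>
  The step that counts hypertrees. Group the sets \<open>A\<close> by the family \<open>B\<close> of blocks they meet. For
  given \<open>B\<close> there are \<open>\<Prod>V\<in>B. card V\<close> such sets, and this number turns the weights of the blocks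
  outside \<open>B\<close> into the full weight of \<open>\<pi>\<close>, leaving only the factor \<open>\<Sum>V\<in>B. card V\<close> from the merged
  block. Summed over all \<open>B\<close>, each block \<open>V\<close> is counted once for each \<open>B\<close> containing it.
\<close>
lemma sum_weight_merge:
  fixes X :: "'a set"
  assumes fin: "finite X" and \<pi>: "partition_on X \<pi>"
  shows "(\<Sum>A | A \<subseteq> X \<and> card A = Suc j \<and> card (touched \<pi> A) = Suc j. \<Prod>V\<in>merge \<pi> A. card V)
       = (\<Prod>V\<in>\<pi>. card V) * card X * ((card \<pi> - 1) choose j)"
proof -
  let ?S = "{A. A \<subseteq> X \<and> card A = Suc j \<and> card (touched \<pi> A) = Suc j}"
  let ?T = "{B. B \<subseteq> \<pi> \<and> card B = Suc j}"
  have fp: "finite \<pi>" using finite_elements[OF fin \<pi>] .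
  have fV: "finite V" if "V \<in> \<pi>" for V
    using that \<pi> fin by (auto simp: partition_on_def intro: finite_subset)
  have dis: "disjoint \<pi>" using \<pi> by (simp add: partition_on_def)
  have fS: "finite ?S" using fin by (auto intro: finite_subset[of _ "Pow X"])
  have fT: "finite ?T" using fp by (auto intro: finite_subset[of _ "Pow \<pi>"])
  have weight: "(\<Prod>V\<in>merge \<pi> A. card V) =
      (\<Sum>V\<in>touched \<pi> A. card V) * (\<Prod>V\<in>\<pi> - touched \<pi> A. card V)" if "A \<in> ?S" for A
  proof -
    have "A \<subseteq> X" "A \<noteq> {}" using that by auto
    moreover have "card (\<Union>(touched \<pi> A)) = (\<Sum>V\<in>touched \<pi> A. card V)"
      using card_Union_disjoint[of "touched \<pi> A"] dis fV touched_subset[of \<pi> A]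
      by (metis pairwise_subset subsetD)
    ultimately show ?thesis
      using Union_touched_notin[OF \<pi>] fp by (simp add: merge_def)
  qed
  have fibre: "card {A \<in> ?S. touched \<pi> A = B} = (\<Prod>V\<in>B. card V)" if "B \<in> ?T" for B
  proof -
    have B: "B \<subseteq> \<pi>" "card B = Suc j" using that by auto
    have t: "touched \<pi> A = B \<longleftrightarrow> A \<subseteq> \<Union>B \<and> (\<forall>V\<in>B. V \<inter> A \<noteq> {})" if "A \<subseteq> X" for A
    proof
      assume "touched \<pi> A = B"
      then show "A \<subseteq> \<Union>B \<and> (\<forall>V\<in>B. V \<inter> A \<noteq> {})"
        using subset_Union_touched[OF \<pi> that] by (auto simp: touched_def)
    next
      assume "A \<subseteq> \<Union>B \<and> (\<forall>V\<in>B. V \<inter> A \<noteq> {})"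
      then show "touched \<pi> A = B"
        using B partition_on_eqI[OF \<pi>] unfolding touched_def by blast
    qed
    have UB: "\<Union>B \<subseteq> X" using B \<pi> by (auto simp: partition_on_def)
    have "{A \<in> ?S. touched \<pi> A = B} =
        {A. A \<subseteq> \<Union>B \<and> card A = card B \<and> (\<forall>V\<in>B. V \<inter> A \<noteq> {})}"
    proof -
      have "A \<in> ?S \<and> touched \<pi> A = B \<longleftrightarrow>
          A \<subseteq> \<Union>B \<and> card A = card B \<and> (\<forall>V\<in>B. V \<inter> A \<noteq> {})" for A
      proof (cases "A \<subseteq> X")
        case True
        show ?thesis using t[OF True] True B(2) by auto
      next
        case False
        then have "\<not> A \<subseteq> \<Union>B" using UB by blast
        then show ?thesis using False by simp
      qed
      then show ?thesis by simp
    qed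
    then show ?thesis
      using card_transversals[of B] B fp fV dis
      by (metis (lifting) finite_subset pairwise_subset subsetD)
  qed
  have "(\<Sum>A\<in>?S. \<Prod>V\<in>merge \<pi> A. card V)
      = (\<Sum>A\<in>?S. (\<Sum>V\<in>touched \<pi> A. card V) * (\<Prod>V\<in>\<pi> - touched \<pi> A. card V))"
    using weight by (intro sum.cong) auto
  also have "\<dots> = (\<Sum>B\<in>?T. \<Sum>A | A \<in> ?S \<and> touched \<pi> A = B.
      (\<Sum>V\<in>touched \<pi> A. card V) * (\<Prod>V\<in>\<pi> - touched \<pi> A. card V))"
    by (rule sum.group[symmetric, OF fS fT]) (auto simp: touched_def)
  also have "\<dots> = (\<Sum>B\<in>?T. card {A \<in> ?S. touched \<pi> A = B} *
      ((\<Sum>V\<in>B. card V) * (\<Prod>V\<in>\<pi> - B. card V)))"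
    by (rule sum.cong) auto
  also have "\<dots> = (\<Sum>B\<in>?T. (\<Prod>V\<in>\<pi>. card V) * (\<Sum>V\<in>B. card V))"
  proof (rule sum.cong[OF refl])
    fix B assume B: "B \<in> ?T"
    then have "(\<Prod>V\<in>\<pi>. card V) = (\<Prod>V\<in>\<pi> - B. card V) * (\<Prod>V\<in>B. card V)"
      using prod.subset_diff[of B \<pi> card] fp by simp
    then show "card {A \<in> ?S. touched \<pi> A = B} * ((\<Sum>V\<in>B. card V) * (\<Prod>V\<in>\<pi> - B. card V))
        = (\<Prod>V\<in>\<pi>. card V) * (\<Sum>V\<in>B. card V)"
      by (simp only: fibre[OF B] mult_ac)
  qed
  also have "\<dots> = (\<Prod>V\<in>\<pi>. card V) * (\<Sum>B\<in>?T. \<Sum>V | V \<in> \<pi> \<and> V \<in> B. card V)"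
  proof -
    have "{V. V \<in> \<pi> \<and> V \<in> B} = B" if "B \<in> ?T" for B using that by auto
    then show ?thesis by (simp add: sum_distrib_left)
  qed
  also have "(\<Sum>B\<in>?T. \<Sum>V | V \<in> \<pi> \<and> V \<in> B. card V) = (\<Sum>V\<in>\<pi>. \<Sum>B | B \<in> ?T \<and> V \<in> B. card V)"
    by (rule sum.swap_restrict[OF fT fp])
  also have "\<dots> = (\<Sum>V\<in>\<pi>. card V * ((card \<pi> - 1) choose j))"
    using card_subsets_containing[OF fp, of _ j] by (intro sum.cong) (auto simp: conj_assoc)
  also have "\<dots> = card X * ((card \<pi> - 1) choose j)"
    using product_partition[OF \<pi> fV] by (simp flip: sum_distrib_right)
  finally show ?thesis by (simp add: mult_ac)
qed

lemma sum_choose_blocks: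
  assumes fin: "finite X" and \<tau>: "partition_on X \<tau>" and "j \<ge> 1"
  shows "(\<Sum>V\<in>\<tau>. card V choose j) = card {A. A \<subseteq> X \<and> card A = j \<and> (\<exists>V\<in>\<tau>. A \<subseteq> V)}"
proof -
  have fV: "finite V" if "V \<in> \<tau>" for V
    using that \<tau> fin by (auto simp: partition_on_def intro: finite_subset)
  have "{A. A \<subseteq> X \<and> card A = j \<and> (\<exists>V\<in>\<tau>. A \<subseteq> V)} = (\<Union>V\<in>\<tau>. {A. A \<subseteq> V \<and> card A = j})"
    using \<tau> by (auto simp: partition_on_def)
  also have "card \<dots> = (\<Sum>V\<in>\<tau>. card {A. A \<subseteq> V \<and> card A = j})"
  proof (rule card_UN_disjoint)
    show "finite \<tau>" using finite_elements[OF fin \<tau>] .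
    show "\<forall>V\<in>\<tau>. finite {A. A \<subseteq> V \<and> card A = j}"
      using fV by (auto intro: finite_subset[of _ "Pow _"])
    show "\<forall>V\<in>\<tau>. \<forall>W\<in>\<tau>. V \<noteq> W \<longrightarrow> {A. A \<subseteq> V \<and> card A = j} \<inter> {A. A \<subseteq> W \<and> card A = j} = {}"
    proof (intro ballI impI equals0I)
      fix V W A assume VW: "V \<in> \<tau>" "W \<in> \<tau>" "V \<noteq> W"
        and "A \<in> {A. A \<subseteq> V \<and> card A = j} \<inter> {A. A \<subseteq> W \<and> card A = j}"
      then have A: "A \<subseteq> V" "A \<subseteq> W" "card A = j" by auto
      then have "A \<noteq> {}" using \<open>j \<ge> 1\<close> by auto
      then show False using VW A partition_on_eqI[OF \<tau>] by blast
    qed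
  qed
  finally show ?thesis using n_subsets[OF fV] by simp
qed

section \<open>Expansion of polynomials in binomial coefficients\<close>

text \<open>
  Multiplication by \<open>x\<close> acts on the binomial basis by
  \<open>x (x choose j) = j (x choose j) + (j+1) (x choose (j+1))\<close>.
\<close>
lemma poly_binomial_expansion:
  fixes p :: "'a::field_char_0 poly"
  shows "\<exists>c. (\<forall>x. poly p (of_nat x) = (\<Sum>j\<le>degree p. c j * of_nat (x choose j)))
           \<and> c (degree p) = fact (degree p) * lead_coeff p"
proof (induction p)
  case 0
  show ?case by (intro exI[of _ "\<lambda>_. 0"]) simp
next
  case (pCons a p)
  then obtain c where c: "\<And>x. poly p (of_nat x) = (\<Sum>j\<le>degree p. c j * of_nat (x choose j))"
    and lead: "c (degree p) = fact (degree p) * lead_coeff p" by auto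
  show ?case
  proof (cases "p = 0")
    case True
    then show ?thesis by (intro exI[of _ "\<lambda>_. a"]) simp
  next
    case False
    let ?m = "degree p"
    \<comment> \<open>coefficients of \<open>a + x p(x)\<close>; the cutoff is needed as \<open>c\<close> is arbitrary beyond \<open>degree p\<close>\<close>
    define d where "d j = (if j = 0 then a else (of_nat j :: 'a) * (if j \<le> ?m then c j else 0)
                            + of_nat j * c (j - 1))" for j
    have step: "of_nat x * of_nat (x choose j) =
        (of_nat j * of_nat (x choose j) + of_nat (Suc j) * of_nat (x choose Suc j) :: 'a)" for x j
    proof -
      have "Suc j * (x choose Suc j) + j * (x choose j) = x * (x choose j)"
        proof (cases "j \<le> x")
        case True
        have "Suc j * (x choose Suc j) = (x - j) * (x choose j)"
          by (simp only: binomial_absorption binomial_absorb_comp)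
        then show ?thesis using True by (simp only: distrib_right[symmetric]) simp
      qed (simp add: binomial_eq_0)
      then have "of_nat (Suc j * (x choose Suc j) + j * (x choose j)) = (of_nat (x * (x choose j)) :: 'a)"
        by (rule arg_cong)
      then show ?thesis by (simp add: algebra_simps)
    qed
    have "poly (pCons a p) (of_nat x) = (\<Sum>j\<le>Suc ?m. d j * of_nat (x choose j))" for x
    proof -
      have "poly (pCons a p) (of_nat x) = a + (\<Sum>j\<le>?m. c j * (of_nat x * of_nat (x choose j)))"
        by (simp add: c sum_distrib_left mult_ac)
      also have "\<dots> = a + (\<Sum>j\<le>?m. of_nat j * c j * of_nat (x choose j))
          + (\<Sum>j\<le>?m. of_nat (Suc j) * c j * of_nat (x choose Suc j))"
        by (simp only: step sum.distrib distrib_left mult_ac add_ac)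
      also have "(\<Sum>j\<le>?m. of_nat j * c j * of_nat (x choose j)) =
          (\<Sum>j\<le>?m. of_nat (Suc j) * (if Suc j \<le> ?m then c (Suc j) else 0) * of_nat (x choose Suc j))"
        using sum.atMost_Suc_shift[of "\<lambda>j. of_nat j * (if j \<le> ?m then c j else 0) * of_nat (x choose j)" ?m]
        by (simp cong: sum.cong_simp)
      also have "a + \<dots> + (\<Sum>j\<le>?m. of_nat (Suc j) * c j * of_nat (x choose Suc j))
          = a + (\<Sum>j\<le>?m. d (Suc j) * of_nat (x choose Suc j))"
        by (simp only: d_def sum.distrib[symmetric] add.assoc) (simp add: distrib_right)
      also have "\<dots> = (\<Sum>j\<le>Suc ?m. d j * of_nat (x choose j))"
        by (subst sum.atMost_Suc_shift) (simp add: d_def)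
      finally show ?thesis .
    qed
    moreover have "d (Suc ?m) = fact (Suc ?m) * lead_coeff p"
      by (simp add: d_def lead mult_ac)
    ultimately show ?thesis using False by (intro exI[of _ d]) simp
  qed
qed

lemma poly_binomial_expansion_no_constant:
  fixes p :: "'a::field_char_0 poly"
  assumes "poly p 0 = 0"
  obtains c where "\<And>x. poly p (of_nat x) = (\<Sum>j=1..degree p. c j * of_nat (x choose j))"
    and "c (degree p) = fact (degree p) * lead_coeff p"
proof -
  obtain c where c: "\<And>x. poly p (of_nat x) = (\<Sum>j\<le>degree p. c j * of_nat (x choose j))"
    and lead: "c (degree p) = fact (degree p) * lead_coeff p"
    using poly_binomial_expansion[of p] by blast
  have split: "{..degree p} = insert 0 {1..degree p}" by auto
  have "(\<Sum>j=1..degree p. c j * of_nat (0 choose j)) = 0"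
    by (rule sum.neutral) (auto simp: binomial_eq_0)
  then have "c 0 = 0" using c[of 0] assms by (simp add: split)
  then have "poly p (of_nat x) = (\<Sum>j=1..degree p. c j * of_nat (x choose j))" for x
    by (simp add: c split)
  then show ?thesis using that lead by blast
qed

section \<open>Weighted hypertree counts\<close>

text \<open>
  Trades one polynomial factor for a sum over merges: the \<open>j\<close>-sets inside a block of \<open>\<tau>\<close> are counted
  by binomials, and exchanging the order of summation turns the condition on \<open>\<tau>\<close> into a larger
  lower bound.
\<close>
lemma sum_coarsenings_expand:
  fixes R :: "'a set set \<Rightarrow> 'b::field_char_0"
  assumes fin: "finite X" and \<pi>: "partition_on X \<pi>"
    and c: "\<And>x. poly p (of_nat x) = (\<Sum>j=1..m. c j * of_nat (x choose j))"
  shows "(\<Sum>\<tau> | refines X \<pi> \<tau>. (\<Sum>V\<in>\<tau>. poly p (of_nat (card V))) * R \<tau>)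
       = (\<Sum>j=1..m. c j * (\<Sum>A | A \<subseteq> X \<and> card A = j. \<Sum>\<tau> | refines X (merge \<pi> A) \<tau>. R \<tau>))"
proof -
  let ?C = "{\<tau>. refines X \<pi> \<tau>}" and ?S = "\<lambda>j. {A. A \<subseteq> X \<and> card A = j}"
  have fC: "finite ?C" using finite_coarsenings[OF fin] .
  have fS: "finite (?S j)" for j using fin by (auto intro: finite_subset[of _ "Pow X"])
  have block: "(\<Sum>V\<in>\<tau>. poly p (of_nat (card V))) * R \<tau>
      = (\<Sum>j=1..m. c j * (\<Sum>A | A \<in> ?S j \<and> (\<exists>V\<in>\<tau>. A \<subseteq> V). R \<tau>))" if "\<tau> \<in> ?C" for \<tau>
  proof -
    have t: "partition_on X \<tau>" using that by (auto simp: refines_def)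
    have "(\<Sum>V\<in>\<tau>. poly p (of_nat (card V))) = (\<Sum>j=1..m. c j * of_nat (\<Sum>V\<in>\<tau>. card V choose j))"
      unfolding c of_nat_sum sum_distrib_left by (rule sum.swap)
    also have "\<dots> = (\<Sum>j=1..m. c j * of_nat (card {A. A \<in> ?S j \<and> (\<exists>V\<in>\<tau>. A \<subseteq> V)}))"
      using sum_choose_blocks[OF fin t] by (intro sum.cong) (auto simp: conj_assoc)
    finally show ?thesis
      by (simp add: sum_distrib_left mult_ac)
  qed
  have upper: "{\<tau>. \<tau> \<in> ?C \<and> (\<exists>V\<in>\<tau>. A \<subseteq> V)} = {\<tau>. refines X (merge \<pi> A) \<tau>}"
    if "A \<in> ?S j" "j \<ge> 1" for A j
  proof -
    have "A \<subseteq> X" "A \<noteq> {}" using that by auto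
    then show ?thesis using refines_merge_iff[OF \<pi>] by simp
  qed
  have "(\<Sum>\<tau>\<in>?C. (\<Sum>V\<in>\<tau>. poly p (of_nat (card V))) * R \<tau>)
      = (\<Sum>\<tau>\<in>?C. \<Sum>j=1..m. c j * (\<Sum>A | A \<in> ?S j \<and> (\<exists>V\<in>\<tau>. A \<subseteq> V). R \<tau>))"
    by (rule sum.cong[OF refl block])
  also have "\<dots> = (\<Sum>j=1..m. c j * (\<Sum>\<tau>\<in>?C. \<Sum>A | A \<in> ?S j \<and> (\<exists>V\<in>\<tau>. A \<subseteq> V). R \<tau>))"
    by (subst sum.swap) (simp only: sum_distrib_left)
  also have "\<dots> = (\<Sum>j=1..m. c j * (\<Sum>A\<in>?S j. \<Sum>\<tau> | \<tau> \<in> ?C \<and> (\<exists>V\<in>\<tau>. A \<subseteq> V). R \<tau>))"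
    by (subst sum.swap_restrict[OF fC fS]) (rule refl)
  also have "\<dots> = (\<Sum>j=1..m. c j * (\<Sum>A\<in>?S j. \<Sum>\<tau> | refines X (merge \<pi> A) \<tau>. R \<tau>))"
    using upper by (intro sum.cong arg_cong2[of _ _ _ _ "(*)"]) auto
  finally show ?thesis .
qed

text \<open>
  Induction on the number of factors needs arbitrary starting partitions \<open>\<pi>\<close>, since using up a
  factor replaces \<open>\<pi>\<close> by \<open>merge \<pi> A\<close>. Both sides carry an extra factor \<open>card X\<close> so that the power of
  \<open>card X\<close> is the number of factors, and the formula also makes sense for the empty product.
\<close>
lemma sum_block_polynomials_top_mobius:
  fixes f :: "'i \<Rightarrow> 'b::field_char_0 poly"
  assumes fin: "finite X" and ne: "X \<noteq> {}" and "finite I"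
    and f0: "\<And>i. i \<in> I \<Longrightarrow> poly (f i) 0 = 0"
    and deg: "\<And>i. i \<in> I \<Longrightarrow> degree (f i) \<ge> 1"
    and \<pi>: "partition_on X \<pi>"
    and blocks: "card \<pi> \<ge> 1 + (\<Sum>i\<in>I. degree (f i) - 1)"
  shows "of_nat (card X) * (\<Sum>\<tau> | refines X \<pi> \<tau>.
            (\<Prod>i\<in>I. \<Sum>V\<in>\<tau>. poly (f i) (of_nat (card V))) * of_int (top_mobius (card \<tau>)))
       = (if card \<pi> = 1 + (\<Sum>i\<in>I. degree (f i) - 1)
          then of_nat (\<Prod>V\<in>\<pi>. card V) * of_nat (card X) ^ card I * fact (card \<pi> - 1)
               * (\<Prod>i\<in>I. of_nat (degree (f i)) * lead_coeff (f i))
          else 0)"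
  using \<open>finite I\<close> f0 deg \<pi> blocks
proof (induction I arbitrary: \<pi> rule: finite_induct)
  case empty
  have "(\<Prod>V\<in>\<pi>. card V) = card X" if "card \<pi> = 1"
    using that empty.prems(3) by (auto simp: card_1_singleton_iff partition_on_def)
  moreover have "(\<Sum>\<tau> | refines X \<pi> \<tau>. of_int (top_mobius (card \<tau>)) :: 'b) = (if card \<pi> = 1 then 1 else 0)"
    using sum_top_mobius_coarsenings[OF fin empty.prems(3) ne] by (simp flip: of_int_sum)
  ultimately show ?case by simp
next
  case (insert i I)
  note \<pi> = insert.prems(3)
  let ?S = "\<lambda>j. {A. A \<subseteq> X \<and> card A = j}"
  let ?n = "of_nat (card X) :: 'b"
  define N where "N = (\<Sum>i\<in>I. degree (f i) - 1)"
  define Q where "Q = (\<Prod>i\<in>I. of_nat (degree (f i)) * lead_coeff (f i))"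
  define K where "K = ?n ^ card I * fact N * Q"
  define R :: "'a set set \<Rightarrow> 'b" where
    "R \<tau> = (\<Prod>i\<in>I. \<Sum>V\<in>\<tau>. poly (f i) (of_nat (card V))) * of_int (top_mobius (card \<tau>))" for \<tau>
  define G where "G \<rho> = ?n * (\<Sum>\<tau> | refines X \<rho> \<tau>. R \<tau>)" for \<rho>
  obtain q where q: "degree (f i) = Suc q"
    using insert.prems(2)[of i] by (cases "degree (f i)") auto
  obtain c where c: "\<And>x. poly (f i) (of_nat x) = (\<Sum>j=1..Suc q. c j * of_nat (x choose j))"
    and lead: "c (Suc q) = fact (Suc q) * lead_coeff (f i)"
    using poly_binomial_expansion_no_constant[of "f i"] insert.prems(1)[of i] q by auto
  have blocks: "card \<pi> \<ge> 1 + q + N"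
    using insert.prems(4) insert.hyps by (simp add: N_def q)
  \<comment> \<open>The induction hypothesis: a merge keeps the number of blocks above the critical value
    unless \<open>\<pi>\<close> itself is critical and \<open>A\<close> meets the largest possible number of blocks.\<close>
  have G: "G (merge \<pi> A) = (if card \<pi> = 1 + q + N \<and> card (touched \<pi> A) = Suc q
       then of_nat (\<Prod>V\<in>merge \<pi> A. card V) * K else 0)"
    if A: "A \<in> ?S j" and j: "j \<in> {1..Suc q}" for A j
  proof -
    have AX: "A \<subseteq> X" "A \<noteq> {}" using A j by auto
    have m: "partition_on X (merge \<pi> A)" by (rule partition_on_merge[OF \<pi> AX])
    have le: "card (touched \<pi> A) \<le> Suc q"
      using card_touched_le[OF \<pi>, of A] AX fin A j by (auto dest: finite_subset)
    have cm: "card (merge \<pi> A) + card (touched \<pi> A) = card \<pi> + 1"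
      by (rule card_merge[OF fin \<pi> AX])
    have ge: "card (merge \<pi> A) \<ge> 1 + N" using le cm blocks by linarith
    have iff: "card (merge \<pi> A) = 1 + N \<longleftrightarrow> card \<pi> = 1 + q + N \<and> card (touched \<pi> A) = Suc q"
      using le cm blocks by linarith
    have "G (merge \<pi> A) = (if card (merge \<pi> A) = 1 + N
        then of_nat (\<Prod>V\<in>merge \<pi> A. card V) * ?n ^ card I * fact (card (merge \<pi> A) - 1) * Q else 0)"
      unfolding G_def R_def N_def Q_def
      using insert.IH[of "merge \<pi> A"] insert.prems(1,2) m ge by (simp add: N_def)
    also have "\<dots> = (if card (merge \<pi> A) = 1 + N then of_nat (\<Prod>V\<in>merge \<pi> A. card V) * K else 0)"
      by (simp add: K_def mult_ac)
    finally show ?thesis by (simp only: iff)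
  qed
  have "?n * (\<Sum>\<tau> | refines X \<pi> \<tau>.
      (\<Prod>i\<in>insert i I. \<Sum>V\<in>\<tau>. poly (f i) (of_nat (card V))) * of_int (top_mobius (card \<tau>)))
    = ?n * (\<Sum>\<tau> | refines X \<pi> \<tau>. (\<Sum>V\<in>\<tau>. poly (f i) (of_nat (card V))) * R \<tau>)"
    using insert.hyps by (simp add: R_def mult_ac)
  also have "\<dots> = (\<Sum>j=1..Suc q. c j * (\<Sum>A\<in>?S j. G (merge \<pi> A)))"
    by (subst sum_coarsenings_expand[OF fin \<pi> c]) (simp only: G_def sum_distrib_left mult_ac)
  also have "\<dots> = (if card \<pi> = 1 + q + N
      then of_nat (\<Prod>V\<in>\<pi>. card V) * ?n ^ Suc (card I) * fact (q + N) * (of_nat (Suc q) * lead_coeff (f i) * Q)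
      else 0)"
  proof (cases "card \<pi> = 1 + q + N")
    case False
    then have "(\<Sum>j=1..Suc q. c j * (\<Sum>A\<in>?S j. G (merge \<pi> A))) = 0"
      using G by (intro sum.neutral ballI) (simp del: sum.cl_ivl_Suc)
    then show ?thesis using False by simp
  next
    case True
    \<comment> \<open>Sets with fewer than \<open>degree (f i)\<close> elements cannot meet enough blocks.\<close>
    have small: "G (merge \<pi> A) = 0" if "A \<in> ?S j" "j \<in> {1..q}" for A j
    proof -
      have "finite A" using that fin finite_subset by auto
      then have "card (touched \<pi> A) \<noteq> Suc q"
        using card_touched_le[OF \<pi>, of A] that by auto
      then show ?thesis using G[of A j] that by auto
    qed
    have "(\<Sum>j=1..Suc q. c j * (\<Sum>A\<in>?S j. G (merge \<pi> A)))
        = (\<Sum>j=1..q. c j * (\<Sum>A\<in>?S j. G (merge \<pi> A))) + c (Suc q) * (\<Sum>A\<in>?S (Suc q). G (merge \<pi> A))"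
      by simp
    also have "(\<Sum>j=1..q. c j * (\<Sum>A\<in>?S j. G (merge \<pi> A))) = 0"
      using small by (intro sum.neutral ballI) simp
    also have "(\<Sum>A\<in>?S (Suc q). G (merge \<pi> A)) =
        (\<Sum>A\<in>?S (Suc q). if card (touched \<pi> A) = Suc q then of_nat (\<Prod>V\<in>merge \<pi> A. card V) * K else 0)"
      using G True by (intro sum.cong) auto
    also have "\<dots> = (\<Sum>A | A \<in> ?S (Suc q) \<and> card (touched \<pi> A) = Suc q. of_nat (\<Prod>V\<in>merge \<pi> A. card V) * K)"
      by (rule sum.inter_filter[symmetric]) (use fin in \<open>auto intro: finite_subset[of _ "Pow X"]\<close>)
    also have "\<dots> = of_nat (\<Sum>A | A \<subseteq> X \<and> card A = Suc q \<and> card (touched \<pi> A) = Suc q. \<Prod>V\<in>merge \<pi> A. card V) * K"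
      by (simp add: sum_distrib_right conj_assoc)
    also have "\<dots> = of_nat ((\<Prod>V\<in>\<pi>. card V) * card X * ((q + N) choose q)) * K"
      by (subst sum_weight_merge[OF fin \<pi>]) (simp add: True)
    finally have "(\<Sum>j=1..Suc q. c j * (\<Sum>A\<in>?S j. G (merge \<pi> A)))
       = of_nat (\<Prod>V\<in>\<pi>. card V) * ?n ^ Suc (card I)
         * (of_nat (fact q * fact N * ((q + N) choose q))) * (of_nat (Suc q) * lead_coeff (f i) * Q)"
      by (simp add: lead K_def mult_ac del: of_nat_Suc of_nat_prod)
    also have "fact q * fact N * ((q + N) choose q) = fact (q + N)"
      using binomial_fact_lemma[of q "q + N"] by simp
    finally show ?thesis using True by simp
  qed
  finally show ?case
    using insert.hyps by (simp add: N_def Q_def q mult_ac)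
qed

theorem theorem1p1:
  fixes k n :: nat and f :: "nat \<Rightarrow> complex poly" and m :: "nat \<Rightarrow> nat"
  assumes f0: "\<And>i. i \<in> {1..k} \<Longrightarrow> poly (f i) 0 = 0"
    and deg: "\<And>i. i \<in> {1..k} \<Longrightarrow> degree (f i) = m i"
    and m: "\<And>i. i \<in> {1..k} \<Longrightarrow> m i \<ge> 1"
  shows "(int n = (\<Sum>i=1..k. int (m i)) - (int k - 1) \<longrightarrow>
           (\<Sum>\<pi>\<in>set_partitions n.
              (\<Prod>i=1..k. \<Sum>V\<in>\<pi>. poly (f i) (of_nat (card V)))
              * of_int (partition_mobius n \<pi> (top_partition n)))
           = fact (n - 1) * of_nat n powi (int k - 1) * (\<Prod>i=1..k. of_nat (m i) * lead_coeff (f i)))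
       \<and> (int n > (\<Sum>i=1..k. int (m i)) - (int k - 1) \<longrightarrow>
           (\<Sum>\<pi>\<in>set_partitions n.
              (\<Prod>i=1..k. \<Sum>V\<in>\<pi>. poly (f i) (of_nat (card V)))
              * of_int (partition_mobius n \<pi> (top_partition n)))
           = 0)"
proof -
  define S where "S = (\<Sum>\<pi>\<in>set_partitions n.
      (\<Prod>i=1..k. \<Sum>V\<in>\<pi>. poly (f i) (of_nat (card V)))
      * (of_int (partition_mobius n \<pi> (top_partition n)) :: complex))"
  define N where "N = (\<Sum>i=1..k. m i - 1)"
  let ?P = "\<Prod>i=1..k. of_nat (m i) * lead_coeff (f i)"
  have "int N = (\<Sum>i=1..k. int (m i) - 1)"
    unfolding N_def of_nat_sum using m by (intro sum.cong) (auto simp: of_nat_diff)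
  then have thr: "(\<Sum>i=1..k. int (m i)) - (int k - 1) = 1 + int N"
    by (simp add: sum_subtractf)
  have S: "of_nat n * S = (if n = 1 + N then of_nat n ^ k * fact (n - 1) * ?P else 0)" if n: "n \<ge> 1 + N"
  proof -
    define X where "X = {1..n}"
    define s where "s = (\<lambda>x. {x}) ` X"
    have s: "partition_on X s" unfolding s_def by (rule partition_on_singletons)
    have X: "finite X" "X \<noteq> {}" "card X = n" using n by (auto simp: X_def)
    have cs: "card s = n" using X by (simp add: s_def card_image)
    have "{\<tau>. refines X s \<tau>} = set_partitions n"
      using s by (auto simp: set_partitions_def refines_def partition_on_def s_def X_def)
    then have S_eq: "S = (\<Sum>\<tau> | refines X s \<tau>.
        (\<Prod>i=1..k. \<Sum>V\<in>\<tau>. poly (f i) (of_nat (card V))) * of_int (top_mobius (card \<tau>)))"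
      unfolding S_def using partition_mobius_top[of n] n
      by (intro sum.cong) (auto simp: set_partitions_def)
    have degs: "(\<Sum>i=1..k. degree (f i) - 1) = N"
      using deg by (simp add: N_def)
    have leads: "(\<Prod>i=1..k. of_nat (degree (f i)) * lead_coeff (f i)) = ?P"
      using deg by (intro prod.cong) auto
    have weight: "(\<Prod>V\<in>s. card V) = 1"
      by (simp add: s_def prod.reindex)
    have blocks: "card s \<ge> 1 + (\<Sum>i=1..k. degree (f i) - 1)"
      unfolding degs cs by (rule n)
    have "of_nat (card X) * S = (if card s = 1 + N
        then of_nat (\<Prod>V\<in>s. card V) * of_nat (card X) ^ card {1..k} * fact (card s - 1) * ?P else 0)"
      unfolding S_eq degs[symmetric] leads[symmetric]
      using f0 deg m by (intro sum_block_polynomials_top_mobius X s blocks) auto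
    then show ?thesis unfolding weight X(3) cs by simp
  qed
  have "S = fact (n - 1) * of_nat n powi (int k - 1) * ?P" if "int n = 1 + int N"
  proof -
    have "n = 1 + N" using that by linarith
    then have "of_nat n * S = of_nat n ^ k * fact (n - 1) * ?P"
      using S by simp
    moreover have n0: "(of_nat n :: complex) \<noteq> 0"
      unfolding of_nat_eq_0_iff using \<open>n = 1 + N\<close> by simp
    moreover have "(of_nat n :: complex) powi (int k - 1) = of_nat n ^ k / of_nat n"
      using n0 by (simp add: power_int_diff)
    ultimately have "of_nat n * S = of_nat n * (fact (n - 1) * of_nat n powi (int k - 1) * ?P)"
      by simp
    then show ?thesis by (simp only: mult_left_cancel[OF n0])
  qed
  moreover have "S = 0" if "int n > 1 + int N"
    using S that by auto
  ultimately show ?thesis unfolding thr S_def by blast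
qed

end
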